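(* Let $G$ be a finite positive graph with at least one edge. Then the polytope of magic labelings $\mathcal{P}_G$ of $G$ is a rational polytope of dimension $q-n+b$, where $q$ is the number of edges of $G$, $n$ is the number of vertices of $G$, and $b$ is the number of connected components of $G$ that are bipartite. The $d$-dimensional faces of $\mathcal{P}_G$ are the $d$-dimensional polytopes of magic labelings of positive subgraphs of $G$ with $n$ vertices and at most $n-b+d$ edges.
   Context: Graphs may have loops. A labeling of $G$ assigns a nonnegative integer to each edge; it is a magic labeling of magic sum $r$ if for each vertex $v$ the sum of the labels of all edges incident to $v$ is $r$ (a loop is counted as incident only once). $G$ is positive if for every edge $e$ of $G$ there is a magic labeling $L$ of $G$ with $L(e)>0$. Let $q$ be the number of edges and let $C_G\subseteq\mathbb{R}^q$ be the cone of all nonnegative real edge-labelings whose sums at all vertices are equal. The polytope of magic labelings of $G$ is $$\mathcal{P}_G=\{L\in C_G\subseteq\mathbb{R}^q : \text{for every vertex } v,\ \textstyle\sum_{e\ni v}L(e)=1\},$$ each edge (including a loop) incident to $v$ being counted once. A polytope is rational if all its vertices have rational coordinates. Faces are nonempty; the faces of $\mathcal{P}_G$ are the nonempty sets of the form $\{L\in\mathcal{P}_G: L(e)=0 \text{ for all } e\in E_0\}$ with $E_0$ a subset of the edge set. For a subgraph $H$ of $G$ with the same vertex set, $\mathcal{P}_H$ is viewed inside $\mathcal{P}_G$ by labeling the edges of $G$ not in $H$ by $0$. *)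

theory Defs
  imports "HOL-Analysis.Analysis"
begin

text \<open>
  Undirected graphs, with loops and multiple edges allowed. An edge is identified with its name in
  \<open>'e\<close>, and its set of endpoints has one element (for a loop) or two. Summing over the edges
  \<open>e\<close> with \<open>v \<in> ends G e\<close> therefore counts a loop at \<open>v\<close> once.
\<close>

record ('v, 'e) ugraph =
  verts :: "'v set"
  edges :: "'e set"
  ends :: "'e \<Rightarrow> 'v set"

definition finite_graph :: "('v, 'e) ugraph \<Rightarrow> bool" where
  "finite_graph G \<longleftrightarrow> finite (verts G) \<and> finite (edges G) \<and>
     (\<forall>e\<in>edges G. ends G e \<subseteq> verts G \<and> card (ends G e) \<in> {1, 2})"

definition subgraph :: "('v, 'e) ugraph \<Rightarrow> ('v, 'e) ugraph \<Rightarrow> bool" where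
  "subgraph H G \<longleftrightarrow> finite_graph H \<and> verts H \<subseteq> verts G \<and> edges H \<subseteq> edges G \<and>
     (\<forall>e\<in>edges H. ends H e = ends G e)"

definition incident_edges :: "('v, 'e) ugraph \<Rightarrow> 'v \<Rightarrow> 'e set" where
  "incident_edges G v = {e \<in> edges G. v \<in> ends G e}"

definition adjacency :: "('v, 'e) ugraph \<Rightarrow> ('v \<times> 'v) set" where
  "adjacency G = {(u, v). \<exists>e\<in>edges G. ends G e = {u, v}}"

definition component_sets :: "('v, 'e) ugraph \<Rightarrow> 'v set set" where
  "component_sets G = {(adjacency G)\<^sup>* `` {v} | v. v \<in> verts G}"

definition induced_subgraph :: "('v, 'e) ugraph \<Rightarrow> 'v set \<Rightarrow> ('v, 'e) ugraph" where
  "induced_subgraph G C = \<lparr>verts = C, edges = {e \<in> edges G. ends G e \<subseteq> C}, ends = ends G\<rparr>"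

definition bipartite :: "('v, 'e) ugraph \<Rightarrow> bool" where
  "bipartite G \<longleftrightarrow> (\<exists>A B. A \<union> B = verts G \<and> A \<inter> B = {} \<and>
     (\<forall>e\<in>edges G. \<exists>a\<in>A. \<exists>b\<in>B. ends G e = {a, b}))"

definition num_bipartite_components :: "('v, 'e) ugraph \<Rightarrow> nat" where
  "num_bipartite_components G = card {C \<in> component_sets G. bipartite (induced_subgraph G C)}"

definition magic_labeling :: "('v, 'e) ugraph \<Rightarrow> ('e \<Rightarrow> nat) \<Rightarrow> nat \<Rightarrow> bool" where
  "magic_labeling G L r \<longleftrightarrow> (\<forall>v\<in>verts G. (\<Sum>e\<in>incident_edges G v. L e) = r)"

definition positive_graph :: "('v, 'e) ugraph \<Rightarrow> bool" where
  "positive_graph G \<longleftrightarrow> (\<forall>e\<in>edges G. \<exists>L r. magic_labeling G L r \<and> L e > 0)"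

text \<open>
  A real edge-labeling of \<open>G\<close> is a vector indexed by the whole type \<open>'e\<close> that vanishes outside
  \<open>edges G\<close>. So the labelings of a subgraph are also labelings of the whole graph, with
  the missing edges labeled by \<open>0\<close>.
\<close>

definition magic_cone :: "('v, 'e::finite) ugraph \<Rightarrow> (real ^ 'e) set" where
  "magic_cone G = {L. (\<forall>e\<in>edges G. 0 \<le> L $ e) \<and> (\<forall>e. e \<notin> edges G \<longrightarrow> L $ e = 0) \<and>
     (\<forall>u\<in>verts G. \<forall>v\<in>verts G. (\<Sum>e\<in>incident_edges G u. L $ e) = (\<Sum>e\<in>incident_edges G v. L $ e))}"

definition magic_polytope :: "('v, 'e::finite) ugraph \<Rightarrow> (real ^ 'e) set" where
  "magic_polytope G = {L \<in> magic_cone G. \<forall>v\<in>verts G. (\<Sum>e\<in>incident_edges G v. L $ e) = 1}"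

definition rational_polytope :: "(real ^ 'e::finite) set \<Rightarrow> bool" where
  "rational_polytope P \<longleftrightarrow> polytope P \<and> (\<forall>x. x extreme_point_of P \<longrightarrow> (\<forall>e. x $ e \<in> \<rat>))"

lemma magic_polytope_iff:
  "L \<in> magic_polytope G \<longleftrightarrow> (\<forall>e\<in>edges G. 0 \<le> L $ e) \<and> (\<forall>e. e \<notin> edges G \<longrightarrow> L $ e = 0) \<and>
     (\<forall>v\<in>verts G. (\<Sum>e\<in>incident_edges G v. L $ e) = 1)"
  unfolding magic_polytope_def magic_cone_def by auto

lemma convex_magic_polytope: "convex (magic_polytope G)"
  unfolding convex_def
  by (auto simp: magic_polytope_iff sum.distrib sum_distrib_left[symmetric])

text \<open>
  The nonempty faces of the polytope, in the general sense of \<open>face_of\<close>, are exactly its nonempty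
  subsets cut out by the vanishing of a set of edge labels.
\<close>

lemma face_of_magic_polytope_iff:
  assumes "F \<noteq> {}"
  shows "F face_of magic_polytope G \<longleftrightarrow>
    (\<exists>E0\<subseteq>edges G. F = {L \<in> magic_polytope G. \<forall>e\<in>E0. L $ e = 0})"
proof
  let ?P = "magic_polytope G"
  assume F: "F face_of ?P"
  have FP: "F \<subseteq> ?P" using F by (rule face_of_imp_subset)
  have cF: "convex F" using F by (rule face_of_imp_convex)
  obtain x where x: "x \<in> rel_interior F"
    using assms cF rel_interior_eq_empty by blast
  have xF: "x \<in> F" using x rel_interior_subset by blast
  have xP: "x \<in> ?P" using xF FP by blast
  define E0 where "E0 = {e \<in> edges G. x $ e = 0}"
  have sub: "y $ e = 0" if y: "y \<in> F" and e: "e \<in> E0" for y e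
  proof -
    obtain c where c: "c > 1" "(1 - c) *\<^sub>R y + c *\<^sub>R x \<in> F"
      using convex_rel_interior_if2[OF cF x] hull_inc[OF y] by metis
    have "(1 - c) * y $ e + c * x $ e \<ge> 0"
      using c(2) FP e unfolding E0_def by (force simp: magic_polytope_iff)
    hence "(c - 1) * y $ e \<le> 0" using e unfolding E0_def by (simp add: algebra_simps)
    hence "y $ e \<le> 0" using c(1) by (simp add: mult_le_0_iff)
    moreover have "y $ e \<ge> 0" using y FP e unfolding E0_def by (force simp: magic_polytope_iff)
    ultimately show ?thesis by simp
  qed
  have sup: "y \<in> F" if y: "y \<in> ?P" and y0: "\<forall>e\<in>E0. y $ e = 0" for y
  proof (cases "y = x")
    case True
    then show ?thesis using xF by simp
  next
    case False
    define m where "m = Min (insert 1 ((\<lambda>e. x $ e) ` {e \<in> edges G. x $ e \<noteq> 0}))"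
    define M where "M = 1 + (\<Sum>e\<in>UNIV. \<bar>y $ e\<bar>)"
    define t where "t = m / M"
    have m: "m > 0" unfolding m_def using xP by (force simp: magic_polytope_iff)
    have M: "M \<ge> 1" unfolding M_def by (simp add: sum_nonneg)
    have t: "t > 0" using m M unfolding t_def by simp
    have ty: "t * y $ e \<le> x $ e" if e: "e \<in> edges G" "x $ e \<noteq> 0" for e
    proof -
      have "\<bar>y $ e\<bar> \<le> (\<Sum>e\<in>UNIV. \<bar>y $ e\<bar>)" by (rule member_le_sum) auto
      hence "y $ e \<le> M" unfolding M_def by linarith
      hence "t * y $ e \<le> t * M" using t by simp
      also have "\<dots> = m" using M unfolding t_def by simp
      also have "\<dots> \<le> x $ e" unfolding m_def using e by (intro Min_le) auto
      finally show ?thesis .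
    qed
    define z where "z = (1 + t) *\<^sub>R x - t *\<^sub>R y"
    have "z \<in> ?P"
      unfolding magic_polytope_iff
    proof (intro conjI ballI allI impI)
      fix e assume e: "e \<in> edges G"
      show "0 \<le> z $ e"
      proof (cases "x $ e = 0")
        case True
        then show ?thesis using y0 e unfolding z_def E0_def by simp
      next
        case False
        have "0 \<le> t * x $ e" using t xP e by (simp add: magic_polytope_iff)
        then show ?thesis using ty[OF e False] unfolding z_def by (simp add: algebra_simps)
      qed
    next
      fix e assume "e \<notin> edges G"
      then show "z $ e = 0" using xP y unfolding z_def by (simp add: magic_polytope_iff)
    next
      fix v assume "v \<in> verts G"
      then show "(\<Sum>e\<in>incident_edges G v. z $ e) = 1"
        using xP y unfolding z_def
        by (simp add: magic_polytope_iff sum_subtractf sum_distrib_left[symmetric])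
    qed
    moreover have "x \<in> open_segment y z"
    proof -
      have "(1 - 1 / (1 + t)) *\<^sub>R y + (1 / (1 + t)) *\<^sub>R z = x"
      proof -
        define s where "s = 1 / (1 + t)"
        have s: "s + s * t = 1" using t unfolding s_def by (simp add: field_simps)
        have "(1 - s) *\<^sub>R y + s *\<^sub>R z = (s + s * t) *\<^sub>R x + (1 - (s + s * t)) *\<^sub>R y"
          unfolding z_def by (simp add: algebra_simps)
        then show ?thesis unfolding s by (simp add: s_def)
      qed
      moreover have "y \<noteq> z"
      proof
        assume "y = z"
        hence "(1 + t) *\<^sub>R (y - x) = 0" unfolding z_def by (simp add: algebra_simps)
        then show False using t False by simp
      qed
      ultimately show ?thesis unfolding in_segment(2) using t
        by (intro conjI exI[of _ "1 / (1 + t)"]) auto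
    qed
    ultimately show ?thesis using face_ofD[OF F _ y _ xF] by blast
  qed
  have "F = {L \<in> ?P. \<forall>e\<in>E0. L $ e = 0}" using sub sup FP by blast
  then show "\<exists>E0\<subseteq>edges G. F = {L \<in> ?P. \<forall>e\<in>E0. L $ e = 0}"
    unfolding E0_def by blast
next
  let ?P = "magic_polytope G"
  assume "\<exists>E0\<subseteq>edges G. F = {L \<in> ?P. \<forall>e\<in>E0. L $ e = 0}"
  then obtain E0 where E0: "E0 \<subseteq> edges G" and F: "F = {L \<in> ?P. \<forall>e\<in>E0. L $ e = 0}" by blast
  have "F = ?P \<inter> (\<Inter>e\<in>E0. {L. L $ e = 0})" using F by blast
  moreover have "convex (?P \<inter> (\<Inter>e\<in>E0. {L. L $ e = 0}))"
    by (intro convex_Int convex_magic_polytope convex_INT) (auto simp: convex_def)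
  ultimately have cF: "convex F" by simp
  have "a \<in> F \<and> b \<in> F"
    if a: "a \<in> ?P" and b: "b \<in> ?P" and x: "x \<in> F" "x \<in> open_segment a b" for a b x
  proof -
    obtain u where u: "0 < u" "u < 1" "x = (1 - u) *\<^sub>R a + u *\<^sub>R b"
      using x(2) unfolding in_segment(2) by blast
    have "a $ e = 0 \<and> b $ e = 0" if e: "e \<in> E0" for e
    proof -
      have *: "(1 - u) * a $ e + u * b $ e = 0" using x(1) e u(3) unfolding F by simp
      have ab: "0 \<le> a $ e" "0 \<le> b $ e" using a b e E0 by (auto simp: magic_polytope_iff)
      then have "0 \<le> (1 - u) * a $ e" "0 \<le> u * b $ e" using u by simp_all
      then have "(1 - u) * a $ e = 0" "u * b $ e = 0" using * by linarith+
      then show ?thesis using u by simp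
    qed
    then show ?thesis using a b unfolding F by simp
  qed
  then show "F face_of ?P"
    unfolding face_of_def using cF F by blast
qed

end

theory Submission
  imports Defs
begin

text \<open>
  The affine hull of the polytope is the solution set of the vertex equations, because a positive
  graph carries a strictly positive solution. Its dimension is therefore \<open>q\<close> minus the rank of
  the incidence rows. A vertex weighting annihilates all rows iff its values are opposite along every
  edge; such a weighting vanishes on a non-bipartite component and is determined by one value on a
  bipartite one, so the rank is \<open>n - b\<close>. An extreme point is the only solution of the vertex
  equations with its support; applying to its coordinates a \<open>\<rat>\<close>-linear retraction
  \<open>\<real> \<rightarrow> \<rat>\<close> gives another such solution, so the coordinates are rational. A face is the polytope
  of the subgraph formed by the edges on which it does not vanish, and the rational extreme points
  show that this subgraph is positive.
\<close>

section \<open>The rank of the incidence rows\<close>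

text \<open>A row of the vertex-edge incidence matrix, with entry 1 rather than 2 at a loop. It
  lives in the space of labelings so that a vertex sum becomes an inner product.\<close>

definition incidence_row :: "('v, 'e::finite) ugraph \<Rightarrow> 'v \<Rightarrow> real ^ 'e" where
  "incidence_row G v = (\<chi> e. if e \<in> incident_edges G v then 1 else 0)"

lemma inner_incidence_row: "incidence_row G v \<bullet> L = (\<Sum>e\<in>incident_edges G v. L $ e)"
proof -
  have "incidence_row G v \<bullet> L = (\<Sum>e\<in>UNIV. if e \<in> incident_edges G v then L $ e else 0)"
    by (auto simp: incidence_row_def inner_vec_def intro!: sum.cong)
  then show ?thesis by (simp add: sum.If_cases)
qed

lemma sym_adjacency: "sym (adjacency G)"
  unfolding adjacency_def by (auto intro!: symI simp: insert_commute)

lemma adjacency_component_eq: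
  assumes "(u, v) \<in> (adjacency G)\<^sup>*"
  shows "(adjacency G)\<^sup>* `` {u} = (adjacency G)\<^sup>* `` {v}"
proof -
  have "(v, u) \<in> (adjacency G)\<^sup>*"
    using assms sym_rtrancl[OF sym_adjacency] by (rule symD[rotated])
  then show ?thesis using assms rtrancl_trans by fast
qed

lemma component_sets_eq:
  assumes "C \<in> component_sets G" "v \<in> C"
  shows "C = (adjacency G)\<^sup>* `` {v}"
proof -
  obtain u where "C = (adjacency G)\<^sup>* `` {u}" using assms(1) unfolding component_sets_def by blast
  then show ?thesis using assms(2) adjacency_component_eq by fast
qed

lemma component_subset_verts:
  assumes "finite_graph G" "C \<in> component_sets G"
  shows "C \<subseteq> verts G"
proof -
  have "v \<in> verts G" if "(u, v) \<in> (adjacency G)\<^sup>*" "u \<in> verts G" for u v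
    using that
  proof (induction rule: rtrancl_induct)
    case (step y z)
    then obtain e where "e \<in> edges G" "ends G e = {y, z}" unfolding adjacency_def by auto
    then show ?case using assms(1) unfolding finite_graph_def by auto
  qed
  then show ?thesis using assms(2) unfolding component_sets_def by auto
qed

lemma ends_cases:
  assumes "finite_graph G" "e \<in> edges G"
  obtains a where "ends G e = {a}" | a b where "ends G e = {a, b}" "a \<noteq> b"
proof -
  have "card (ends G e) = 1 \<or> card (ends G e) = 2" using assms unfolding finite_graph_def by simp
  then show ?thesis using that by (metis card_1_singletonE card_2_iff)
qed

lemma ends_subset_component:
  assumes "finite_graph G" "C \<in> component_sets G" "e \<in> edges G" "v \<in> ends G e" "v \<in> C"
  shows "ends G e \<subseteq> C"
proof
  fix w assume w: "w \<in> ends G e"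
  have "w = v \<or> ends G e = {v, w}"
    using assms(1,3)
  proof (cases rule: ends_cases)
    case 1
    then show ?thesis using assms(4) w by simp
  next
    case 2
    then show ?thesis using assms(4) w by auto
  qed
  then have "w = v \<or> (v, w) \<in> adjacency G" using assms(3) unfolding adjacency_def by auto
  then show "w \<in> C" using component_sets_eq[OF assms(2,5)] by auto
qed

text \<open>The hypothesis on \<open>y\<close> is a linear relation among incidence rows, read one
  edge at a time. Two ends of an edge carry opposite values, so the absolute value propagates along
  paths.\<close>

lemma abs_constant_on_component:
  fixes y :: "'v \<Rightarrow> real"
  assumes y: "\<And>e. e \<in> edges G \<Longrightarrow> (\<Sum>v\<in>ends G e. y v) = 0"
    and "(u, v) \<in> (adjacency G)\<^sup>*"
  shows "\<bar>y v\<bar> = \<bar>y u\<bar>"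
  using assms(2)
proof (induction rule: rtrancl_induct)
  case (step v w)
  then obtain e where e: "e \<in> edges G" "ends G e = {v, w}" unfolding adjacency_def by auto
  have "\<bar>y w\<bar> = \<bar>y v\<bar>" using y[OF e(1)] e(2) by (cases "v = w") auto
  then show ?case using step by simp
qed simp

text \<open>With the absolute value constant and nonzero, only the sign varies, and the sign is a
  proper 2-colouring. A loop would force the value 0 at its vertex, so none occurs.\<close>

lemma bipartite_component_if_nonzero:
  fixes y :: "'v \<Rightarrow> real"
  assumes G: "finite_graph G" and C: "C \<in> component_sets G" and u: "u \<in> C" "y u \<noteq> 0"
    and y: "\<And>e. e \<in> edges G \<Longrightarrow> (\<Sum>v\<in>ends G e. y v) = 0"
  shows "bipartite (induced_subgraph G C)"
proof -
  have abs: "\<bar>y v\<bar> = \<bar>y u\<bar>" if "v \<in> C" for v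
    using abs_constant_on_component[of G y, OF y] that component_sets_eq[OF C u(1)] by auto
  define A B where "A = {v \<in> C. y v > 0}" and "B = {v \<in> C. y v < 0}"
  have "A \<union> B = C" unfolding A_def B_def using abs u by force
  moreover have "\<exists>a\<in>A. \<exists>b\<in>B. ends G e = {a, b}" if e: "e \<in> edges G" "ends G e \<subseteq> C" for e
    using G e(1)
  proof (cases rule: ends_cases)
    case (1 a)
    then show ?thesis using y[OF e(1)] e(2) abs[of a] u by simp
  next
    case (2 a b)
    then have ab: "y a + y b = 0" "a \<in> C" "b \<in> C" using y[OF e(1)] e(2) by auto
    then have "a \<in> A \<and> b \<in> B \<or> b \<in> A \<and> a \<in> B"
      unfolding A_def B_def using abs[of a] u by auto
    then show ?thesis using 2 by (auto simp: insert_commute)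
  qed
  ultimately show ?thesis unfolding bipartite_def induced_subgraph_def
    by (intro exI[of _ A] exI[of _ B]) (auto simp: A_def B_def)
qed

text \<open>Each edge of the component has exactly one end on either side, and every other edge has
  none, so both sums have the same coordinates. This is the linear relation that each bipartite
  component contributes.\<close>

lemma bipartite_component_row_sums:
  assumes G: "finite_graph G" and C: "C \<in> component_sets G"
    and AB: "A \<union> B = C" "A \<inter> B = {}"
      "\<And>e. e \<in> edges G \<Longrightarrow> ends G e \<subseteq> C \<Longrightarrow> \<exists>a\<in>A. \<exists>b\<in>B. ends G e = {a, b}"
  shows "(\<Sum>v\<in>A. incidence_row G v) = (\<Sum>v\<in>B. incidence_row G v)"
proof (rule vec_eq_iff[THEN iffD2], rule allI)
  fix e
  have fin: "finite A" "finite B"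
    using component_subset_verts[OF G C] G AB(1) unfolding finite_graph_def
    by (auto intro: finite_subset)
  have count: "(\<Sum>v\<in>X. incidence_row G v) $ e = card {v \<in> X. e \<in> incident_edges G v}"
    if "finite X" for X
    using that by (simp add: incidence_row_def sum.If_cases Int_def)
  have "card {v \<in> A. e \<in> incident_edges G v} = card {v \<in> B. e \<in> incident_edges G v}"
  proof (cases "e \<in> edges G \<and> ends G e \<inter> C \<noteq> {}")
    case True
    then have "ends G e \<subseteq> C" using ends_subset_component[OF G C] by blast
    then obtain a b where "a \<in> A" "b \<in> B" "ends G e = {a, b}" using AB(3) True by blast
    then have "{v \<in> A. e \<in> incident_edges G v} = {a}" "{v \<in> B. e \<in> incident_edges G v} = {b}"
      using AB True unfolding incident_edges_def by auto
    then show ?thesis by simp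
  next
    case False
    then have "{v \<in> A. e \<in> incident_edges G v} = {}" "{v \<in> B. e \<in> incident_edges G v} = {}"
      using AB(1) unfolding incident_edges_def by auto
    then show ?thesis by (simp only:)
  qed
  then show "(\<Sum>v\<in>A. incidence_row G v) $ e = (\<Sum>v\<in>B. incidence_row G v) $ e"
    using count fin by simp
qed

text \<open>Independence of the image as a set does not see repeated vectors. Injectivity is
  therefore recorded too, so that the dimension is the size of the index set.\<close>

lemma indexed_independent:
  fixes f :: "'i \<Rightarrow> 'a::real_vector"
  assumes "finite I" and ind: "\<And>y. (\<Sum>i\<in>I. y i *\<^sub>R f i) = 0 \<Longrightarrow> \<forall>i\<in>I. y i = 0"
  shows "inj_on f I" "independent (f ` I)"
proof -
  show inj: "inj_on f I"
  proof (rule inj_onI, rule ccontr)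
    fix i j assume ij: "i \<in> I" "j \<in> I" "f i = f j" "i \<noteq> j"
    \<comment> \<open>Coefficients 1 and -1 at two indices with the same vector give a nontrivial
      relation.\<close>
    define y where "y k = (if k = i then 1 else if k = j then -1 else 0 :: real)" for k
    have "(\<Sum>k\<in>I. y k *\<^sub>R f k) = (\<Sum>k\<in>{i, j}. y k *\<^sub>R f k)"
      using assms(1) ij by (intro sum.mono_neutral_right) (auto simp: y_def)
    also have "\<dots> = 0" using ij by (simp add: y_def)
    finally show False using ind[of y] ij by (auto simp: y_def)
  qed
  show "independent (f ` I)"
    unfolding dependent_finite[OF finite_imageI[OF assms(1)]]
    using ind[of "u \<circ> f" for u] by (auto simp: sum.reindex[OF inj])
qed

text \<open>Choose a root in every bipartite component. The rows of the remaining vertices form a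
  basis of the row space.\<close>

lemma dim_incidence_rows:
  fixes G :: "('v, 'e::finite) ugraph"
  assumes G: "finite_graph G"
  shows "dim (incidence_row G ` verts G) + num_bipartite_components G = card (verts G)"
proof -
  define \<C> where "\<C> = {C \<in> component_sets G. bipartite (induced_subgraph G C)}"
  have \<C>: "C \<in> component_sets G" if "C \<in> \<C>" for C using that unfolding \<C>_def by simp
  have "\<forall>C\<in>\<C>. \<exists>v. v \<in> C" using \<C> unfolding component_sets_def by blast
  then obtain \<rho> where \<rho>: "\<And>C. C \<in> \<C> \<Longrightarrow> \<rho> C \<in> C" by metis
  have same: "C = D" if "C \<in> \<C>" "D \<in> \<C>" "v \<in> C" "v \<in> D" for C D v
    using that \<C> component_sets_eq by metis
  define T where "T = \<rho> ` \<C>"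
  have T: "T \<subseteq> verts G" using \<rho> \<C> component_subset_verts[OF G] unfolding T_def by blast
  have "inj_on \<rho> \<C>" using \<rho> same by (metis inj_onI)
  then have card_T: "card T = num_bipartite_components G"
    unfolding T_def \<C>_def num_bipartite_components_def by (rule card_image)
  have fin: "finite (verts G)" using G unfolding finite_graph_def by simp
  define I where "I = verts G - T"
  have finite_I: "finite I" using fin unfolding I_def by simp
  have ind: "\<forall>v\<in>I. y v = 0" if y: "(\<Sum>v\<in>I. y v *\<^sub>R incidence_row G v) = 0" for y
  proof
    fix v assume v: "v \<in> I"
    \<comment> \<open>Extending the coefficients by 0 to the roots lets coordinate \<open>e\<close>
      of the relation be read as a sum over all ends of \<open>e\<close>.\<close>
    define z where "z v = (if v \<in> I then y v else 0)" for v
    have z: "(\<Sum>v\<in>ends G e. z v) = 0" if e: "e \<in> edges G" for e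
    proof -
      have "0 = (\<Sum>v\<in>I. y v *\<^sub>R incidence_row G v) $ e" using y by simp
      also have "\<dots> = (\<Sum>v\<in>I. if v \<in> ends G e then z v else 0)"
        using e by (auto simp: z_def incidence_row_def incident_edges_def intro!: sum.cong)
      also have "\<dots> = (\<Sum>v\<in>I \<inter> ends G e. z v)"
        using fin by (simp add: I_def sum.inter_restrict)
      also have "\<dots> = (\<Sum>v\<in>ends G e. z v)"
        using G e fin unfolding finite_graph_def
        by (intro sum.mono_neutral_left) (auto simp: z_def intro: finite_subset)
      finally show ?thesis by simp
    qed
    define C where "C = (adjacency G)\<^sup>* `` {v}"
    have C: "C \<in> component_sets G" "v \<in> C"
      using v unfolding C_def I_def component_sets_def by auto
    \<comment> \<open>A nonzero value would make the component of \<open>v\<close> bipartite. Its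
      root would then have the same nonzero absolute value, but \<open>z\<close> is 0 at
      roots.\<close>
    show "y v = 0"
    proof (rule ccontr)
      assume "y v \<noteq> 0"
      then have "z v \<noteq> 0" using v by (simp add: z_def)
      then have "C \<in> \<C>"
        using bipartite_component_if_nonzero[OF G C, of z] z C unfolding \<C>_def by blast
      then have "\<rho> C \<in> C" "\<rho> C \<in> T" using \<rho> unfolding T_def by auto
      moreover from this(1) have "\<bar>z (\<rho> C)\<bar> = \<bar>z v\<bar>"
        using abs_constant_on_component[of G z, OF z, of v "\<rho> C"] unfolding C_def by blast
      moreover have "z w = 0" if "w \<in> T" for w using that by (simp add: z_def I_def)
      ultimately show False using \<open>z v \<noteq> 0\<close> by simp
    qed
  qed
  have span: "incidence_row G v \<in> span (incidence_row G ` I)" if v: "v \<in> verts G" for v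
  proof (cases "v \<in> T")
    case False
    then show ?thesis using v unfolding I_def by (auto intro: span_base)
  next
    case True
    then obtain C where C: "C \<in> \<C>" "v = \<rho> C" unfolding T_def by auto
    obtain A B where AB: "A \<union> B = C" "A \<inter> B = {}"
      and E: "\<And>e. e \<in> edges G \<Longrightarrow> ends G e \<subseteq> C \<Longrightarrow> \<exists>a\<in>A. \<exists>b\<in>B. ends G e = {a, b}"
      using C(1) unfolding \<C>_def bipartite_def induced_subgraph_def by auto
    have CV: "C \<subseteq> verts G" using component_subset_verts[OF G \<C>[OF C(1)]] .
    have CI: "C - {v} \<subseteq> I"
    proof
      fix w assume w: "w \<in> C - {v}"
      then have "w \<notin> T" using C \<rho> same unfolding T_def by blast
      then show "w \<in> I" using w CV unfolding I_def by blast
    qed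
    have sum: "(\<Sum>v\<in>A. incidence_row G v) = (\<Sum>v\<in>B. incidence_row G v)"
      using bipartite_component_row_sums[OF G \<C>[OF C(1)] AB E] by blast
    \<comment> \<open>The relation between the two sides is solved for the row of the root. The
      claim is stated for generic \<open>X\<close> and \<open>Y\<close> because the root may lie in
      \<open>A\<close> or in \<open>B\<close>.\<close>
    have *: "incidence_row G v \<in> span (incidence_row G ` I)"
      if X: "v \<in> X" "v \<notin> Y" "X \<union> Y = C"
        "(\<Sum>v\<in>X. incidence_row G v) = (\<Sum>v\<in>Y. incidence_row G v)" for X Y
    proof -
      have "finite X" using X(3) CV fin by (auto intro: finite_subset)
      then have "incidence_row G v = (\<Sum>v\<in>Y. incidence_row G v) - (\<Sum>v\<in>X - {v}. incidence_row G v)"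
        using X(1,4) by (simp add: sum_diff1)
      also have "\<dots> \<in> span (incidence_row G ` I)"
        using X CI by (intro span_diff span_sum span_base imageI) auto
      finally show ?thesis .
    qed
    have "v \<in> C" using C \<rho> by simp
    then show ?thesis using *[of A B] *[of B A] AB sum by auto
  qed
  have "dim (incidence_row G ` verts G) = dim (incidence_row G ` I)"
    using span by (intro order_antisym dim_mono dim_subset) (auto simp: I_def)
  also have "\<dots> = card I"
    using indexed_independent[where f = "incidence_row G", OF finite_I ind]
    by (simp add: dim_eq_card_independent card_image)
  finally show ?thesis
    using T fin card_T card_mono[OF fin T] finite_subset[OF T fin] unfolding I_def
    by (simp add: card_Diff_subset)
qed

section \<open>The dimension of the polytope\<close>

text \<open>Adding up one witness labeling per edge makes all labels positive at once; dividing by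
  the total magic sum normalizes it.\<close>

lemma positive_point_exists:
  fixes G :: "('v, 'e::finite) ugraph"
  assumes G: "finite_graph G" and pos: "positive_graph G" and ne: "edges G \<noteq> {}"
  obtains p where "p \<in> magic_polytope G" "\<And>e. e \<in> edges G \<Longrightarrow> p $ e > 0"
proof -
  obtain L r where Lr: "\<And>e. e \<in> edges G \<Longrightarrow> magic_labeling G (L e) (r e)"
      "\<And>e. e \<in> edges G \<Longrightarrow> L e e > 0"
    using pos unfolding positive_graph_def by metis
  define M where "M f = (\<Sum>e\<in>edges G. L e f)" for f
  define R where "R = (\<Sum>e\<in>edges G. r e)"
  have M: "M f > 0" if "f \<in> edges G" for f
    unfolding M_def using that Lr(2)[OF that] by (intro sum_pos2[of _ f]) auto
  have sum: "(\<Sum>f\<in>incident_edges G v. M f) = R" if "v \<in> verts G" for v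
    unfolding M_def R_def using that Lr(1)
    by (subst sum.swap) (auto simp: magic_labeling_def intro!: sum.cong)
  obtain e where e: "e \<in> edges G" using ne by blast
  then obtain v where v: "v \<in> ends G e" by (rule ends_cases[OF G]) auto
  then have "v \<in> verts G" "e \<in> incident_edges G v"
    using G e unfolding finite_graph_def incident_edges_def by auto
  \<comment> \<open>The vertex \<open>v\<close> is an end of an edge with a positive label, so the
    common sum cannot be 0.\<close>
  then have R: "R > 0"
    using sum[of v] M[OF e] member_le_sum[of e "incident_edges G v" M] by simp
  define p :: "real ^ 'e" where "p = (\<chi> f. if f \<in> edges G then real (M f) / real R else 0)"
  have "(\<Sum>f\<in>incident_edges G v. p $ f) = 1" if "v \<in> verts G" for v
  proof -
    have "(\<Sum>f\<in>incident_edges G v. p $ f) = (\<Sum>f\<in>incident_edges G v. real (M f) / real R)"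
      by (intro sum.cong) (auto simp: p_def incident_edges_def)
    also have "\<dots> = real (\<Sum>f\<in>incident_edges G v. M f) / real R"
      by (simp add: sum_divide_distrib)
    finally show ?thesis using sum[OF that] R by simp
  qed
  then have "p \<in> magic_polytope G" unfolding magic_polytope_iff by (auto simp: p_def)
  then show ?thesis using that M R by (simp add: p_def)
qed

text \<open>Rank-nullity: the kernel is the orthogonal complement of the row space, taken inside the
  coordinate subspace of \<open>edges G\<close>, which contains the rows.\<close>

lemma incidence_kernel_dim:
  fixes G :: "('v, 'e::finite) ugraph"
  shows "dim {L :: real ^ 'e. (\<forall>e. e \<notin> edges G \<longrightarrow> L $ e = 0) \<and>
            (\<forall>v\<in>verts G. incidence_row G v \<bullet> L = 0)} + dim (incidence_row G ` verts G)
      = card (edges G)"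
proof -
  let ?W = "{L :: real ^ 'e. \<forall>e. e \<notin> edges G \<longrightarrow> L $ e = 0}"
  let ?R = "span (incidence_row G ` verts G)"
  have W: "subspace ?W" by (auto simp: subspace_def)
  have RW: "?R \<subseteq> ?W"
    by (rule span_minimal[OF _ W]) (auto simp: incidence_row_def incident_edges_def)
  have "dim ?W = card (edges G)"
    using dim_substandard_cart[where 'a = real, of "edges G"] by (simp add: dim_vec_eq)
  moreover have "{y \<in> ?W. \<forall>x\<in>?R. orthogonal x y} =
      {L. (\<forall>e. e \<notin> edges G \<longrightarrow> L $ e = 0) \<and> (\<forall>v\<in>verts G. incidence_row G v \<bullet> L = 0)}"
    (is "?l = ?r")
  proof
    show "?l \<subseteq> ?r" by (auto simp: orthogonal_def intro: span_base)
    have "orthogonal x y" if "y \<in> ?r" "x \<in> ?R" for x y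
      using that(2)
      by (rule orthogonal_commute[THEN iffD1, OF orthogonal_to_span])
        (use that(1) in \<open>auto simp: orthogonal_def inner_commute\<close>)
    then show "?r \<subseteq> ?l" by blast
  qed
  ultimately show ?thesis
    using dim_subspace_orthogonal_to_vectors[OF subspace_span W RW] by simp
qed

lemma aff_dim_magic_polytope:
  fixes G :: "('v, 'e::finite) ugraph"
  assumes G: "finite_graph G" and pos: "positive_graph G" and ne: "edges G \<noteq> {}"
  shows "aff_dim (magic_polytope G)
    = int (card (edges G)) - int (card (verts G)) + int (num_bipartite_components G)"
proof -
  obtain p where p: "p \<in> magic_polytope G" "\<And>e. e \<in> edges G \<Longrightarrow> p $ e > 0"
    by (rule positive_point_exists[OF assms]) blast
  define K where "K = {L :: real ^ 'e. (\<forall>e. e \<notin> edges G \<longrightarrow> L $ e = 0) \<and>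
      (\<forall>v\<in>verts G. incidence_row G v \<bullet> L = 0)}"
  define A where "A = (+) p ` K"
  \<comment> \<open>The polytope lies between \<open>A \<inter> U\<close> and the affine space
    \<open>A\<close>. Since \<open>U\<close> is open and meets \<open>A\<close> in \<open>p\<close>,
    both bounds have the same dimension.\<close>
  define U where "U = {L :: real ^ 'e. \<forall>e\<in>edges G. 0 < L $ e}"
  have K: "subspace K" unfolding K_def by (auto simp: subspace_def inner_add_right)
  have A: "x \<in> A \<longleftrightarrow> x - p \<in> K" for x
    unfolding A_def by (auto simp: image_iff algebra_simps intro: bexI[of _ "x - p"])
  have P_A: "magic_polytope G \<subseteq> A"
    using p(1)
    by (auto simp: A K_def inner_diff_right magic_polytope_iff inner_incidence_row[symmetric])
  have A_P: "A \<inter> U \<subseteq> magic_polytope G"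
    using p(1)
    by (auto simp: A K_def U_def inner_diff_right magic_polytope_iff
        inner_incidence_row[symmetric] less_imp_le)
  have "open U"
    unfolding U_def Ball_def[symmetric]
    by (simp add: Collect_ball_eq open_INT open_Collect_less continuous_intros)
  moreover have "p \<in> A \<inter> U" using p P_A unfolding U_def by auto
  moreover have "convex A" unfolding A_def using K by (simp add: subspace_imp_convex convex_translation)
  ultimately have "aff_dim (A \<inter> U) = aff_dim A"
    by (intro aff_dim_convex_Int_open) auto
  then have "aff_dim (magic_polytope G) = aff_dim A"
    using aff_dim_subset[OF P_A] aff_dim_subset[OF A_P] by simp
  also have "\<dots> = int (dim K)"
    unfolding A_def by (simp add: aff_dim_translation_eq aff_dim_subspace[OF K])
  finally show ?thesis
    using incidence_kernel_dim[of G] dim_incidence_rows[OF G] unfolding K_def by linarith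
qed

section \<open>Rationality\<close>

text \<open>Finitely many linear conditions cut out a polyhedron. It is bounded because each label
  is one summand of a nonnegative sum equal to 1 at an end of its edge.\<close>

lemma polytope_magic_polytope:
  fixes G :: "('v, 'e::finite) ugraph"
  assumes G: "finite_graph G"
  shows "polytope (magic_polytope G)"
proof -
  have "magic_polytope G = (\<Inter>e\<in>edges G. {L. axis e 1 \<bullet> L \<ge> 0}) \<inter>
      (\<Inter>e\<in>- edges G. {L. axis e 1 \<bullet> L = 0}) \<inter> (\<Inter>v\<in>verts G. {L. incidence_row G v \<bullet> L = 1})"
    by (auto simp: magic_polytope_iff inner_axis' inner_incidence_row)
  also have "polyhedron \<dots>"
    using G unfolding finite_graph_def
    by (intro polyhedron_Int polyhedron_Inter)
      (auto simp: polyhedron_hyperplane polyhedron_halfspace_ge)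
  finally have "polyhedron (magic_polytope G)" .
  moreover have "magic_polytope G \<subseteq> cbox 0 1"
  proof
    fix L assume L: "L \<in> magic_polytope G"
    have "0 \<le> L $ e \<and> L $ e \<le> 1" for e
    proof (cases "e \<in> edges G")
      case True
      then obtain v where "v \<in> ends G e" by (rule ends_cases[OF G]) auto
      then have v: "v \<in> verts G" "e \<in> incident_edges G v"
        using True G unfolding finite_graph_def incident_edges_def by auto
      then have "L $ e \<le> (\<Sum>e\<in>incident_edges G v. L $ e)"
        using L by (intro member_le_sum) (auto simp: magic_polytope_iff incident_edges_def)
      then show ?thesis using L v True by (simp add: magic_polytope_iff)
    qed (use L in \<open>simp add: magic_polytope_iff\<close>)
    then show "L \<in> cbox 0 1" by (simp add: mem_box_cart)
  qed
  ultimately show ?thesis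
    unfolding polytope_eq_bounded_polyhedron using bounded_cbox bounded_subset by blast
qed

text \<open>In the reals as a vector space over the rationals, the vector 1 is independent, so
  prescribing the value 1 there extends to a linear functional (a Hamel basis argument).\<close>

lemma rat_linear_retraction:
  obtains \<phi> :: "real \<Rightarrow> real" where "\<And>x y. \<phi> (x + y) = \<phi> x + \<phi> y" "\<phi> 1 = 1" "\<And>x. \<phi> x \<in> \<rat>"
proof -
  let ?s = "\<lambda>(q::rat) (x::real). of_rat q * x"
  have "vector_space ?s" "vector_space ((*) :: rat \<Rightarrow> rat \<Rightarrow> rat)"
    by (unfold_locales; simp add: algebra_simps of_rat_add of_rat_mult)+
  then interpret vector_space_pair ?s "(*) :: rat \<Rightarrow> rat \<Rightarrow> rat"
    by (rule vector_space_pair.intro)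
  have "vs1.independent {1 :: real}" by (simp add: vs1.dependent_single)
  then obtain g where g: "Vector_Spaces.linear ?s (*) g" "g 1 = (1 :: rat)"
    using linear_independent_extend[of "{1}" "\<lambda>_. 1"] by auto
  then have "g (x + y) = g x + g y" for x y by (simp add: linear_add)
  then show ?thesis using g by (intro that[of "\<lambda>x. of_rat (g x)"]) (auto simp: of_rat_add)
qed

text \<open>A second solution supported where \<open>x\<close> is would give a segment through
  \<open>x\<close> that stays in the polytope for a short distance both ways. Negative entries of
  \<open>y\<close> are allowed.\<close>

lemma extreme_point_unique:
  fixes G :: "('v, 'e::finite) ugraph"
  assumes x: "x extreme_point_of magic_polytope G"
    and supp: "\<And>e. x $ e = 0 \<Longrightarrow> y $ e = 0"
    and sums: "\<And>v. v \<in> verts G \<Longrightarrow> (\<Sum>e\<in>incident_edges G v. y $ e) = 1"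
  shows "y = x"
proof (rule ccontr)
  assume "y \<noteq> x"
  have xP: "x \<in> magic_polytope G" using x unfolding extreme_point_of_def by blast
  \<comment> \<open>The least nonzero coordinate of \<open>x\<close>, capped at 1; the inserted 1
    also keeps the set nonempty.\<close>
  define m where "m = Min (insert 1 ((\<lambda>e. x $ e) ` {e. x $ e \<noteq> 0}))"
  have x0: "x $ e \<ge> 0" for e using xP by (cases "e \<in> edges G") (auto simp: magic_polytope_iff)
  have m: "m > 0" unfolding m_def using x0 by (subst Min_gr_iff) (auto simp: less_le)
  \<comment> \<open>A displacement of norm \<open>m\<close> moves no coordinate by more than
    \<open>m\<close>, so nonzero coordinates of \<open>x\<close> stay nonnegative; the zero ones do
    not move.\<close>
  define t where "t = m / norm (y - x)"
  have t: "t > 0" "t * norm (y - x) = m" using m \<open>y \<noteq> x\<close> unfolding t_def by auto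
  have le: "\<bar>t * (y - x) $ e\<bar> \<le> x $ e" for e
  proof (cases "x $ e = 0")
    case False
    have "\<bar>t * (y - x) $ e\<bar> \<le> t * norm (y - x)"
      unfolding abs_mult using t(1) component_le_norm_cart[of "y - x" e] by simp
    also have "\<dots> \<le> x $ e" unfolding t m_def using False by (intro Min_le) auto
    finally show ?thesis .
  qed (simp add: supp)
  have P: "x + s *\<^sub>R (y - x) \<in> magic_polytope G" if s: "\<bar>s\<bar> = t" for s
    unfolding magic_polytope_iff
  proof (intro conjI ballI allI impI)
    fix e
    have "\<bar>s * (y - x) $ e\<bar> \<le> x $ e" using le[of e] s t(1) by (simp add: abs_mult)
    then show "0 \<le> (x + s *\<^sub>R (y - x)) $ e" by simp
  next
    fix e assume "e \<notin> edges G"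
    then have "x $ e = 0" using xP by (simp add: magic_polytope_iff)
    then show "(x + s *\<^sub>R (y - x)) $ e = 0" using supp by simp
  next
    fix v assume "v \<in> verts G"
    then show "(\<Sum>e\<in>incident_edges G v. (x + s *\<^sub>R (y - x)) $ e) = 1"
      using xP sums[of v]
      by (simp add: magic_polytope_iff sum.distrib sum_subtractf sum_distrib_left[symmetric])
  qed
  define a b where "a = x + t *\<^sub>R (y - x)" and "b = x + (- t) *\<^sub>R (y - x)"
  have "a - b = (2 * t) *\<^sub>R (y - x)" unfolding a_def b_def by (simp add: algebra_simps flip: scaleR_add_left)
  then have "a \<noteq> b" using t \<open>y \<noteq> x\<close> by auto
  moreover have "midpoint a b = x"
    unfolding midpoint_def a_def b_def by (simp flip: scaleR_2)
  ultimately have "x \<in> open_segment a b" using midpoint_in_open_segment by metis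
  moreover have "a \<in> magic_polytope G" "b \<in> magic_polytope G"
    unfolding a_def b_def using t by (auto intro!: P simp del: scaleR_minus_left)
  ultimately show False using x unfolding extreme_point_of_def by blast
qed

lemma extreme_point_rational:
  fixes G :: "('v, 'e::finite) ugraph"
  assumes x: "x extreme_point_of magic_polytope G"
  shows "x $ e \<in> \<rat>"
proof -
  obtain \<phi> :: "real \<Rightarrow> real"
    where \<phi>: "\<And>x y. \<phi> (x + y) = \<phi> x + \<phi> y" "\<phi> 1 = 1" "\<And>x. \<phi> x \<in> \<rat>"
    using rat_linear_retraction by blast
  have \<phi>0: "\<phi> 0 = 0" using \<phi>(1)[of 0 0] by simp
  have \<phi>sum: "(\<Sum>e\<in>X. \<phi> (x $ e)) = \<phi> (\<Sum>e\<in>X. x $ e)" if "finite X" for X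
    using that by (induction X) (auto simp: \<phi> \<phi>0)
  have xP: "x \<in> magic_polytope G" using x unfolding extreme_point_of_def by blast
  \<comment> \<open>The support condition is \<open>\<phi> 0 = 0\<close>, and the vertex equations
    survive by additivity and \<open>\<phi> 1 = 1\<close>. Possible negative values of
    \<open>\<phi>\<close> do no harm in the uniqueness lemma.\<close>
  have "(\<chi> e. \<phi> (x $ e)) = x"
    by (rule extreme_point_unique[OF x]) (use xP in \<open>auto simp: \<phi>0 \<phi>sum \<phi>(2) magic_polytope_iff\<close>)
  then have "x $ e = \<phi> (x $ e)" by (metis vec_lambda_beta)
  then show ?thesis using \<phi>(3)[of "x $ e"] by simp
qed

lemma common_denominator:
  fixes f :: "'a \<Rightarrow> real"
  assumes "finite A" "\<And>a. a \<in> A \<Longrightarrow> f a \<in> \<rat>"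
  shows "\<exists>N>0. \<forall>a\<in>A. real N * f a \<in> \<int>"
  using assms
proof (induction A rule: finite_induct)
  case (insert a A)
  then obtain N where N: "N > 0" "\<forall>a\<in>A. real N * f a \<in> \<int>" by auto
  obtain i k where k: "f a = of_int i / of_int k" "k > 0"
    using insert.prems[of a] by (auto elim: Rats_cases')
  have "real (N * nat k) * f c \<in> \<int>" if "c \<in> insert a A" for c
  proof (cases "c = a")
    case True
    then have "real (N * nat k) * f c = of_int (int N * i)" using k by simp
    then show ?thesis by (metis Ints_of_int)
  next
    case False
    then have "real (N * nat k) * f c = of_int k * (real N * f c)" using k by simp
    then show ?thesis using N False that by (metis Ints_mult Ints_of_int insertE)
  qed
  then show ?case using N k by (intro exI[of _ "N * nat k"]) auto
qed (auto intro: exI[of _ 1])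

text \<open>A real labeling positive at \<open>e\<close> may be irrational, but some extreme point
  is also positive there. Extreme points are rational, and clearing denominators gives an integer
  labeling whose magic sum is the denominator.\<close>

lemma positive_graph_if_positive_labels:
  fixes G :: "('v, 'e::finite) ugraph"
  assumes G: "finite_graph G"
    and pos: "\<And>e. e \<in> edges G \<Longrightarrow> \<exists>L\<in>magic_polytope G. L $ e > 0"
  shows "positive_graph G"
  unfolding positive_graph_def
proof
  fix e assume e: "e \<in> edges G"
  let ?P = "magic_polytope G"
  obtain L where L: "L \<in> ?P" "L $ e > 0" using pos[OF e] by blast
  have hull: "?P = convex hull {x. x extreme_point_of ?P}"
    using polytope_magic_polytope[OF G]
    by (intro Krein_Milman_Minkowski) (auto simp: polytope_imp_compact polytope_imp_convex)
  \<comment> \<open>Otherwise the convex hull of the extreme points, which contains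
    \<open>L\<close>, would lie in the hyperplane where label \<open>e\<close> vanishes.\<close>
  have "\<exists>x. x extreme_point_of ?P \<and> x $ e \<noteq> 0"
  proof (rule ccontr)
    assume "\<not> ?thesis"
    then have "convex hull {x. x extreme_point_of ?P} \<subseteq> {x. x $ e = 0}"
      by (intro hull_minimal) (auto simp: convex_def)
    then show False using L hull by auto
  qed
  then obtain x where x: "x extreme_point_of ?P" "x $ e \<noteq> 0" by blast
  have xP: "x \<in> ?P" using x unfolding extreme_point_of_def by blast
  obtain N where N: "N > 0" "\<And>f. real N * x $ f \<in> \<int>"
    using common_denominator[of UNIV "\<lambda>f. x $ f"] extreme_point_rational[OF x(1)] by auto
  \<comment> \<open>Neither \<open>nat\<close> nor the floor loses anything, since the scaled labels
    are nonnegative integers.\<close>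
  define M where "M f = nat \<lfloor>real N * x $ f\<rfloor>" for f
  have x0: "x $ f \<ge> 0" for f using xP by (cases "f \<in> edges G") (auto simp: magic_polytope_iff)
  have M: "real (M f) = real N * x $ f" for f
    using N(2)[of f] x0[of f] unfolding M_def by (auto elim!: Ints_cases)
  have "(\<Sum>f\<in>incident_edges G v. M f) = N" if "v \<in> verts G" for v
  proof -
    have "real (\<Sum>f\<in>incident_edges G v. M f) = real N * (\<Sum>f\<in>incident_edges G v. x $ f)"
      by (simp add: M sum_distrib_left)
    also have "\<dots> = real N" using xP that by (simp add: magic_polytope_iff)
    finally show ?thesis by (simp only: of_nat_eq_iff)
  qed
  moreover have "M e > 0"
  proof -
    have "real (M e) > 0" using M[of e] x0[of e] x(2) N(1) by simp
    then show ?thesis by simp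
  qed
  ultimately show "\<exists>L r. magic_labeling G L r \<and> L e > 0"
    unfolding magic_labeling_def by blast
qed

section \<open>Faces and subgraphs\<close>

text \<open>On equal vertex sets both graphs impose the same equations once the missing edges carry
  0. This puts subgraph polytopes in the form of faces.\<close>

lemma magic_polytope_subgraph:
  fixes G :: "('v, 'e::finite) ugraph"
  assumes H: "subgraph H G" "verts H = verts G"
  shows "magic_polytope H = {L \<in> magic_polytope G. \<forall>e\<in>edges G - edges H. L $ e = 0}"
proof -
  have sub: "edges H \<subseteq> edges G" "\<And>e. e \<in> edges H \<Longrightarrow> ends H e = ends G e"
    using H(1) unfolding subgraph_def by auto
  have "(\<Sum>e\<in>incident_edges H v. L $ e) = (\<Sum>e\<in>incident_edges G v. L $ e)"
    if "\<And>e. e \<notin> edges H \<Longrightarrow> L $ e = 0" for L :: "real ^ 'e" and v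
    using that sub by (intro sum.mono_neutral_left) (auto simp: incident_edges_def)
  then have sums: "(\<Sum>e\<in>incident_edges H v. L $ e) = (\<Sum>e\<in>incident_edges G v. L $ e)"
    if "\<forall>e. e \<notin> edges H \<longrightarrow> L $ e = 0" for L :: "real ^ 'e" and v
    using that by blast
  show ?thesis
  proof (intro set_eqI iffI)
    fix L assume "L \<in> magic_polytope H"
    then show "L \<in> {L \<in> magic_polytope G. \<forall>e\<in>edges G - edges H. L $ e = 0}"
      using sums[of L] sub(1) H(2)
      by (simp add: magic_polytope_iff) (metis order_refl subsetD)
  next
    fix L assume L: "L \<in> {L \<in> magic_polytope G. \<forall>e\<in>edges G - edges H. L $ e = 0}"
    then have "\<forall>e. e \<notin> edges H \<longrightarrow> L $ e = 0" by (auto simp: magic_polytope_iff)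
    then show "L \<in> magic_polytope H"
      using L sums[of L] sub(1) H(2) by (auto simp: magic_polytope_iff)
  qed
qed

text \<open>Erasing the coordinates of deleted edges is a linear map from the rows of
  \<open>G\<close> onto those of \<open>H\<close>. Hence deleting edges while keeping the vertices
  cannot lower the number of bipartite components.\<close>

lemma dim_incidence_rows_subgraph:
  fixes G :: "('v, 'e::finite) ugraph"
  assumes H: "subgraph H G"
  shows "dim (incidence_row H ` V) \<le> dim (incidence_row G ` V)"
proof -
  let ?f = "\<lambda>L :: real ^ 'e. (\<chi> e. if e \<in> edges H then L $ e else 0) :: real ^ 'e"
  have "linear ?f" by (auto intro!: linearI simp: vec_eq_iff)
  moreover have "incidence_row H v = ?f (incidence_row G v)" for v
    using H by (auto simp: incidence_row_def incident_edges_def subgraph_def vec_eq_iff)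
  then have "incidence_row H ` V = ?f ` incidence_row G ` V" by (simp add: image_image)
  ultimately show ?thesis by (simp add: dim_image_le)
qed

lemma face_obtains_positive_subgraph:
  fixes G :: "('v, 'e::finite) ugraph"
  assumes G: "finite_graph G" and F: "F face_of magic_polytope G" "F \<noteq> {}"
  obtains H where "subgraph H G" "positive_graph H" "verts H = verts G" "F = magic_polytope H"
proof -
  obtain E0 where E0: "E0 \<subseteq> edges G" "F = {L \<in> magic_polytope G. \<forall>e\<in>E0. L $ e = 0}"
    using F(1) unfolding face_of_magic_polytope_iff[OF F(2)] by blast
  \<comment> \<open>Removing only \<open>E0\<close> would not suffice: further edges may be forced
    to 0 throughout \<open>F\<close>, and keeping them would spoil positivity.\<close>
  define H where "H = \<lparr>verts = verts G, edges = {e \<in> edges G. \<exists>L\<in>F. L $ e > 0}, ends = ends G\<rparr>"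
  have H: "subgraph H G" "verts H = verts G" "finite_graph H"
    using G unfolding H_def subgraph_def finite_graph_def by auto
  have FP: "F \<subseteq> magic_polytope G" using E0 by blast
  have "L $ e = 0" if "L \<in> F" "e \<in> edges G - edges H" for L e
    using that FP unfolding H_def by (force simp: magic_polytope_iff)
  moreover have "E0 \<subseteq> edges G - edges H" using E0 unfolding H_def by auto
  ultimately have eq: "F = magic_polytope H"
    using FP E0(2) unfolding magic_polytope_subgraph[OF H(1,2)] by blast
  moreover have "positive_graph H"
    by (rule positive_graph_if_positive_labels[OF H(3)]) (auto simp: eq[symmetric], auto simp: H_def)
  ultimately show ?thesis using that H by blast
qed

theorem theorem1p5p4:
  fixes G :: "('v, 'e::finite) ugraph" and q n b :: nat
  assumes "finite_graph G" and "positive_graph G" and "edges G \<noteq> {}"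
    and "q = card (edges G)" and "n = card (verts G)" and "b = num_bipartite_components G"
  shows "rational_polytope (magic_polytope G)
    \<and> aff_dim (magic_polytope G) = int q - int n + int b
    \<and> (\<forall>d::nat. {F. F face_of magic_polytope G \<and> F \<noteq> {} \<and> aff_dim F = int d} =
          {magic_polytope H | H. subgraph H G \<and> positive_graph H \<and> card (verts H) = n
             \<and> int (card (edges H)) \<le> int n - int b + int d
             \<and> aff_dim (magic_polytope H) = int d})"
proof (intro conjI allI)
  note G = assms(1)
  show "rational_polytope (magic_polytope G)"
    unfolding rational_polytope_def
    using polytope_magic_polytope[OF G] extreme_point_rational by blast
  show "aff_dim (magic_polytope G) = int q - int n + int b"
    using aff_dim_magic_polytope assms by blast
  have ne: "verts G \<noteq> {}"
    using G assms(3) unfolding finite_graph_def by fastforce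
  fix d :: nat
  show "{F. F face_of magic_polytope G \<and> F \<noteq> {} \<and> aff_dim F = int d} =
          {magic_polytope H | H. subgraph H G \<and> positive_graph H \<and> card (verts H) = n
             \<and> int (card (edges H)) \<le> int n - int b + int d
             \<and> aff_dim (magic_polytope H) = int d}" (is "?l = ?r")
  proof (intro equalityI subsetI)
    fix F assume "F \<in> ?l"
    then have F: "F face_of magic_polytope G" "F \<noteq> {}" "aff_dim F = int d" by auto
    obtain H where H: "subgraph H G" "positive_graph H" "verts H = verts G" "F = magic_polytope H"
      using face_obtains_positive_subgraph[OF G F(1,2)] by blast
    have fH: "finite_graph H" using H(1) unfolding subgraph_def by simp
    \<comment> \<open>Without edges every vertex sum would be 0 instead of 1, and there is at least
      one vertex.\<close>
    have "edges H \<noteq> {}"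
      using F(2) ne H(3) unfolding H(4) by (auto simp: magic_polytope_iff incident_edges_def)
    then have "int d = int (card (edges H)) - int n + int (num_bipartite_components H)"
      using aff_dim_magic_polytope[OF fH H(2)] F(3) H assms by simp
    \<comment> \<open>The rank cannot grow on passing to \<open>H\<close> while the vertices stay
      the same. With the dimension formula for \<open>H\<close> this yields the edge bound.\<close>
    moreover have "b \<le> num_bipartite_components H"
      using dim_incidence_rows_subgraph[OF H(1), of "verts G"] dim_incidence_rows[OF fH]
        dim_incidence_rows[OF G] H(3) assms(6) by simp
    ultimately show "F \<in> ?r" using H F(3) assms by auto
  next
    fix F assume "F \<in> ?r"
    then obtain H where H: "F = magic_polytope H" "subgraph H G" "card (verts H) = n"
      "aff_dim F = int d" by blast
    have "verts H = verts G"
      using H(2,3) G assms(5) unfolding subgraph_def finite_graph_def by (simp add: card_subset_eq)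
    then have "F = {L \<in> magic_polytope G. \<forall>e\<in>edges G - edges H. L $ e = 0}"
      using magic_polytope_subgraph H(1,2) by blast
    \<comment> \<open>The empty set has affine dimension -1, whereas \<open>d\<close> is a natural
      number.\<close>
    moreover have "F \<noteq> {}" using H(4) by auto
    ultimately show "F \<in> ?l" using face_of_magic_polytope_iff[of F G] H(4) by blast
  qed
qed

end
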